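(* Let $\lambda\in\,]0,1[$, let $f_0:=\mathrm{ent}$ be the negative Boltzmann--Shannon entropy on $\mathbb{R}$ and let $f_1:=\tfrac12|\cdot|^2$ on $\mathbb{R}$. Let $f_\lambda^*:=\mathcal{P}(f_0^*,\lambda,f_1^* )$. Then for every $x\in\mathbb{R}$, $$ \begin{aligned} f_\lambda^*(x) ={}& (1-\lambda)\,\mathcal{W}\!\left(e^{\left(\frac{2}{\lambda}-2\right)\mathcal{W}\left(\frac{\lambda}{2-\lambda}e^{\frac{2x}{2-\lambda}}\right)+\frac{2x}{2-\lambda}}\right)+\frac{\lambda x^2}{4-2\lambda}\\ &+\frac12(1-\lambda)\,\mathcal{W}\!\left(e^{\left(\frac{2}{\lambda}-2\right)\mathcal{W}\left(\frac{\lambda}{2-\lambda}e^{\frac{2x}{2-\lambda}}\right)+\frac{2x}{2-\lambda}}\right)^2\\ &+\frac{(\lambda-1)^2(\lambda-2)}{\lambda^2}\,\mathcal{W}\!\left(\frac{\lambda}{2-\lambda}e^{\frac{2x}{2-\lambda}}\right)^2 . \end{aligned} $$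
   Context: $\mathcal{W}$ denotes the principal real branch of the Lambert W function, i.e. the inverse of $x\mapsto xe^x$; for $z>0$, $\mathcal{W}(z)$ is the unique $w>0$ with $we^w=z$. The negative Boltzmann--Shannon entropy is $\mathrm{ent}:\mathbb{R}\to\mathbb{R}\cup\{\infty\}$ with $\mathrm{ent}(x)=x\log x-x$ for $x>0$, $\mathrm{ent}(0)=0$, and $\mathrm{ent}(x)=\infty$ for $x<0$. The Fenchel conjugate of $f:\mathbb{R}\to[-\infty,\infty]$ is $f^*(x)=\sup_{y\in\mathbb{R}}\{xy-f(y)\}$. It is well known that $f_0^*=\exp$ and $f_1^*=\tfrac12|\cdot|^2$ for $f_0=\mathrm{ent}$ and $f_1=\tfrac12|\cdot|^2$. For convex, lower semicontinuous, proper functions $g_0,g_1:\mathbb{R}\to\,]-\infty,\infty]$ and $\lambda\in[0,1]$, the proximal average is $$\mathcal{P}(g_0,\lambda,g_1)=\left((1-\lambda)\left(g_0+\tfrac12(\cdot)^2\right)^*+\lambda\left(g_1+\tfrac12(\cdot)^2\right)^*\right)^*-\tfrac12(\cdot)^2 .$$ The notation $f_\lambda^*$ is unambiguous because it is known that $(\mathcal{P}(f_0,\lambda,f_1))^*=\mathcal{P}(f_0^*,\lambda,f_1^* )$. *)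

theory Defs
  imports Complex_Main "HOL-Library.Extended_Real"
begin

text \<open>
  The principal real branch is the inverse of the restriction of \<open>w \<mapsto> w * exp w\<close> to
  \<open>{-1..}\<close>, where this map is injective with range \<open>{- exp (- 1)..}\<close>; outside that range the
  value is unspecified.
\<close>

definition lambert_W :: "real \<Rightarrow> real" where
  "lambert_W = the_inv_into {-1..} (\<lambda>w. w * exp w)"

definition ent :: "real \<Rightarrow> ereal" where
  "ent x = (if x > 0 then ereal (x * ln x - x) else if x = 0 then 0 else \<infinity>)"

definition energy :: "real \<Rightarrow> ereal" where
  "energy x = ereal (1 / 2 * \<bar>x\<bar>\<^sup>2)"

definition fenchel_conj :: "(real \<Rightarrow> ereal) \<Rightarrow> real \<Rightarrow> ereal" where
  "fenchel_conj f x = (SUP y. ereal (x * y) - f y)"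

text \<open>
  Meant for convex, lower semicontinuous, proper \<open>g0\<close>, \<open>g1\<close> and \<open>0 \<le> lam \<le> 1\<close>. Then the two inner
  conjugates are finite everywhere (both are proper and have affine minorants), so neither \<open>0 * \<infinity>\<close> nor
  \<open>\<infinity> - \<infinity>\<close> occurs.
\<close>

definition proximal_average ::
    "(real \<Rightarrow> ereal) \<Rightarrow> real \<Rightarrow> (real \<Rightarrow> ereal) \<Rightarrow> real \<Rightarrow> ereal" where
  "proximal_average g0 lam g1 x =
     fenchel_conj (\<lambda>u. ereal (1 - lam) * fenchel_conj (\<lambda>y. g0 y + ereal (1 / 2 * y\<^sup>2)) u
                     + ereal lam * fenchel_conj (\<lambda>y. g1 y + ereal (1 / 2 * y\<^sup>2)) u) x
     - ereal (1 / 2 * x\<^sup>2)"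

end

theory Submission imports Defs
begin

text \<open>
  Every conjugate involved is computed by the equality case of the Fenchel--Young inequality
  (\<open>fenchel_conj_eqI\<close>): an affine minorant of slope \<open>s\<close> that touches \<open>f\<close> at \<open>y0\<close> gives
  \<open>f\<^sup>*(s) = s * y0 - f(y0)\<close>.

  The conjugates of \<open>ent\<close> and \<open>energy\<close> are \<open>exp\<close> and \<open>energy\<close>. In the conjugate of
  \<open>exp + y\<^sup>2/2\<close> at \<open>u\<close> the optimal \<open>y\<close> solves \<open>y + exp y = u\<close>, so \<open>exp y = W(exp u)\<close>, and the value is
  \<open>u\<^sup>2/2 - w - w\<^sup>2/2\<close> with \<open>w = W(exp u)\<close>; the conjugate of \<open>energy + y\<^sup>2/2\<close> is \<open>u\<^sup>2/4\<close>.
  Let \<open>h\<close> be the average of these two with weights \<open>1 - lam\<close> and \<open>lam\<close>. It has slope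
  \<open>(1 - lam) * y + lam * u / 2\<close> at \<open>u = y + exp y\<close>
  (\<open>lambert_conjugate_tangent_le\<close>, \<open>fenchel_conj_average\<close>). For the conjugate of \<open>h\<close> at \<open>x\<close> this slope must equal \<open>x\<close>,
  that is, \<open>(2 - lam) * y + lam * exp y = 2 * x\<close>. With \<open>v = lam / (2 - lam) * exp y\<close> the condition becomes
  \<open>v * exp v = lam / (2 - lam) * exp (2 * x / (2 - lam))\<close>, whence the inner occurrence of \<open>W\<close>, and
  \<open>u = (2 / lam - 2) * v + 2 * x / (2 - lam)\<close>, whence the outer one.
\<close>

lemma strict_mono_on_mult_exp: "strict_mono_on {-1..} (\<lambda>w::real. w * exp w)"
proof (rule strict_mono_onI)
  fix a b :: real
  assume "a \<in> {-1..}" "b \<in> {-1..}" "a < b"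
  show "a * exp a < b * exp b"
  proof (rule DERIV_pos_imp_increasing_open[OF \<open>a < b\<close>])
    fix w :: real
    assume "a < w" "w < b"
    have "((\<lambda>w. w * exp w) has_real_derivative (1 + w) * exp w) (at w)"
      by (auto intro!: derivative_eq_intros simp: algebra_simps)
    moreover have "0 < (1 + w) * exp w"
      using \<open>a \<in> {-1..}\<close> \<open>a < w\<close> by simp
    ultimately show "\<exists>y. ((\<lambda>w. w * exp w) has_real_derivative y) (at w) \<and> 0 < y"
      by blast
  qed (auto intro!: continuous_intros)
qed

lemma lambert_W_mult_exp:
  assumes "-1 \<le> w"
  shows "lambert_W (w * exp w) = w"
  unfolding lambert_W_def
  using the_inv_into_f_f[OF strict_mono_on_imp_inj_on[OF strict_mono_on_mult_exp], of w] assms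
  by simp

lemma lambert_W_pos:
  assumes "0 < z"
  shows "0 < lambert_W z" and "lambert_W z * exp (lambert_W z) = z"
proof -
  have "z * 1 \<le> z * exp z"
    using assms by (intro mult_left_mono) auto
  then have "\<exists>w\<ge>0. w \<le> z \<and> w * exp w = z"
    using assms by (intro IVT') (auto intro!: continuous_intros)
  then obtain w where w: "0 \<le> w" "w * exp w = z"
    by blast
  then have "lambert_W z = w"
    using lambert_W_mult_exp[of w] by simp
  moreover have "w \<noteq> 0"
    using w assms by auto
  ultimately show "0 < lambert_W z" "lambert_W z * exp (lambert_W z) = z"
    using w by auto
qed

lemma ln_lambert_W:
  assumes "0 < z"
  shows "ln (lambert_W z) + lambert_W z = ln z"
proof -
  have "ln z = ln (lambert_W z * exp (lambert_W z))"
    using lambert_W_pos[OF assms] by simp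
  also have "\<dots> = ln (lambert_W z) + lambert_W z"
    using lambert_W_pos(1)[OF assms] by (simp add: ln_mult)
  finally show ?thesis ..
qed

lemma fenchel_conj_eqI:
  assumes touch: "f y0 = ereal c"
    and minorant: "\<And>y. ereal (c + s * (y - y0)) \<le> f y"
  shows "fenchel_conj f s = ereal (s * y0 - c)"
  unfolding fenchel_conj_def
proof (rule antisym)
  show "(SUP y. ereal (s * y) - f y) \<le> ereal (s * y0 - c)"
  proof (rule SUP_least)
    fix y
    show "ereal (s * y) - f y \<le> ereal (s * y0 - c)"
      using minorant[of y] by (cases "f y") (auto simp: algebra_simps)
  qed
  show "ereal (s * y0 - c) \<le> (SUP y. ereal (s * y) - f y)"
    by (rule SUP_upper2[of y0]) (auto simp: touch)
qed

lemma exp_tangent_le: "exp a * (1 + (y - a)) \<le> exp (y::real)"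
proof -
  have "exp a * (1 + (y - a)) \<le> exp a * exp (y - a)"
    by (intro mult_left_mono exp_ge_add_one_self) auto
  then show ?thesis
    by (simp flip: exp_add)
qed

lemma square_tangent_le: "a\<^sup>2 + 2 * a * (y - a) \<le> (y::real)\<^sup>2"
  using zero_le_power2[of "y - a"] by (simp add: power2_eq_square algebra_simps)

lemma fenchel_conj_ent: "fenchel_conj ent x = ereal (exp x)"
proof -
  have minorant: "ereal (x * exp x - exp x + x * (y - exp x)) \<le> ent y" for y
  proof (cases "0 < y")
    case True
    have "y * (1 + (x - ln y)) \<le> exp x"
      using exp_tangent_le[of "ln y" x] True by simp
    then show ?thesis
      using True by (simp add: ent_def algebra_simps)
  qed (auto simp: ent_def zero_ereal_def algebra_simps)
  have "fenchel_conj ent x = ereal (x * exp x - (x * exp x - exp x))"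
    by (rule fenchel_conj_eqI[OF _ minorant]) (simp add: ent_def mult.commute)
  then show ?thesis
    by simp
qed

lemma fenchel_conj_energy: "fenchel_conj energy = energy"
proof
  fix x
  have "fenchel_conj energy x = ereal (x * x - 1 / 2 * x\<^sup>2)"
  proof (rule fenchel_conj_eqI)
    fix y
    show "ereal (1 / 2 * x\<^sup>2 + x * (y - x)) \<le> energy y"
      using square_tangent_le[of x y] by (simp add: energy_def)
  qed (simp add: energy_def)
  then show "fenchel_conj energy x = energy x"
    by (simp add: energy_def power2_eq_square)
qed

lemma fenchel_conj_exp_plus_square:
  "fenchel_conj (\<lambda>y. ereal (exp y) + ereal (1 / 2 * y\<^sup>2)) (a + exp a) =
    ereal ((a + exp a) * a - (exp a + 1 / 2 * a\<^sup>2))"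
proof (rule fenchel_conj_eqI)
  fix y
  show "ereal (exp a + 1 / 2 * a\<^sup>2 + (a + exp a) * (y - a)) \<le> ereal (exp y) + ereal (1 / 2 * y\<^sup>2)"
    using exp_tangent_le[of a y] square_tangent_le[of a y] by (simp add: algebra_simps)
qed simp

text \<open>
  The formula in terms of the Lambert function follows by eliminating the optimal point
  \<open>ln (W (exp u)) = u - W (exp u)\<close>.
\<close>

lemma fenchel_conj_exp_plus_square_lambert:
  "fenchel_conj (\<lambda>y. ereal (exp y) + ereal (1 / 2 * y\<^sup>2)) u =
    ereal (1 / 2 * u\<^sup>2 - lambert_W (exp u) - 1 / 2 * (lambert_W (exp u))\<^sup>2)"
proof -
  define w where "w = lambert_W (exp u)"
  have "0 < w" "ln w + w = u"
    using lambert_W_pos[of "exp u"] ln_lambert_W[of "exp u"] by (auto simp: w_def)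
  then have "exp (u - w) = w" "u - w + exp (u - w) = u"
    by (auto simp flip: \<open>ln w + w = u\<close>)
  then show ?thesis
    using fenchel_conj_exp_plus_square[of "u - w"]
    by (simp add: w_def[symmetric] power2_eq_square field_simps)
qed

lemma fenchel_conj_energy_plus_square:
  "fenchel_conj (\<lambda>y. energy y + ereal (1 / 2 * y\<^sup>2)) u = ereal (u\<^sup>2 / 4)"
proof -
  have "fenchel_conj (\<lambda>y. energy y + ereal (1 / 2 * y\<^sup>2)) u = ereal (u * (u / 2) - (u / 2)\<^sup>2)"
  proof (rule fenchel_conj_eqI)
    fix y
    show "ereal ((u / 2)\<^sup>2 + u * (y - u / 2)) \<le> energy y + ereal (1 / 2 * y\<^sup>2)"
      using square_tangent_le[of "u / 2" y] by (simp add: energy_def)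
  qed (simp add: energy_def power_divide)
  then show ?thesis
    by (simp add: power2_eq_square)
qed

text \<open>
  The affine minorant of the conjugate of \<open>exp + y\<^sup>2/2\<close> that touches it at \<open>a + exp a\<close> has slope \<open>a\<close>:
  it is the member at \<open>y = a\<close> of the family whose supremum is that conjugate.
\<close>

lemma lambert_conjugate_tangent_le:
  fixes a u :: real
  defines "g \<equiv> \<lambda>u. 1 / 2 * u\<^sup>2 - lambert_W (exp u) - 1 / 2 * (lambert_W (exp u))\<^sup>2"
  shows "g (a + exp a) + a * (u - (a + exp a)) \<le> g u"
proof -
  have g: "fenchel_conj (\<lambda>y. ereal (exp y) + ereal (1 / 2 * y\<^sup>2)) u = ereal (g u)" for u
    unfolding g_def by (rule fenchel_conj_exp_plus_square_lambert)
  have "ereal (u * a) - (ereal (exp a) + ereal (1 / 2 * a\<^sup>2)) \<le> ereal (g u)"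
    unfolding g[symmetric] fenchel_conj_def by (rule SUP_upper) simp
  moreover have "g (a + exp a) = (a + exp a) * a - (exp a + 1 / 2 * a\<^sup>2)"
    using fenchel_conj_exp_plus_square[of a] g[of "a + exp a"] by simp
  ultimately show ?thesis
    by (simp add: algebra_simps)
qed

text \<open>
  The assumption \<open>slope\<close> says that \<open>x\<close> is the slope of the averaged function at \<open>a + exp a\<close>, so that
  the supremum is attained there.
\<close>

lemma fenchel_conj_average:
  fixes lam a x :: real
  assumes "0 \<le> lam" "lam \<le> 1"
    and slope: "(1 - lam) * a + lam * (a + exp a) / 2 = x"
  defines "g \<equiv> \<lambda>u. 1 / 2 * u\<^sup>2 - lambert_W (exp u) - 1 / 2 * (lambert_W (exp u))\<^sup>2"
  shows "fenchel_conj (\<lambda>u. ereal ((1 - lam) * g u + lam * (u\<^sup>2 / 4))) x =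
    ereal (x * (a + exp a) - ((1 - lam) * g (a + exp a) + lam * ((a + exp a)\<^sup>2 / 4)))"
proof (rule fenchel_conj_eqI)
  fix u
  define u0 where "u0 = a + exp a"
  have "(1 - lam) * (g u0 + a * (u - u0)) \<le> (1 - lam) * g u"
    unfolding g_def u0_def using \<open>lam \<le> 1\<close>
    by (intro mult_left_mono lambert_conjugate_tangent_le) auto
  moreover have "lam * (u0\<^sup>2 + 2 * u0 * (u - u0)) \<le> lam * u\<^sup>2"
    using \<open>0 \<le> lam\<close> by (intro mult_left_mono square_tangent_le) auto
  moreover have "(1 - lam) * (g u0 + a * (u - u0)) + lam * (u0\<^sup>2 + 2 * u0 * (u - u0)) / 4
      = (1 - lam) * g u0 + lam * (u0\<^sup>2 / 4) + x * (u - u0)"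
    unfolding slope[symmetric, folded u0_def] by (simp add: field_simps)
  ultimately show "ereal ((1 - lam) * g (a + exp a) + lam * ((a + exp a)\<^sup>2 / 4) + x * (u - (a + exp a)))
      \<le> ereal ((1 - lam) * g u + lam * (u\<^sup>2 / 4))"
    by (simp flip: u0_def)
qed simp

theorem theorem3p9:
  fixes lam x :: real
  assumes "0 < lam" and "lam < 1"
  shows "proximal_average (fenchel_conj ent) lam (fenchel_conj energy) x =
    ereal (
      (1 - lam) * lambert_W (exp ((2 / lam - 2) * lambert_W (lam / (2 - lam) * exp (2 * x / (2 - lam)))
                                 + 2 * x / (2 - lam)))
      + lam * x\<^sup>2 / (4 - 2 * lam)
      + 1 / 2 * (1 - lam) * (lambert_W (exp ((2 / lam - 2) * lambert_W (lam / (2 - lam) * exp (2 * x / (2 - lam)))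
                                 + 2 * x / (2 - lam))))\<^sup>2
      + (lam - 1)\<^sup>2 * (lam - 2) / lam\<^sup>2 * (lambert_W (lam / (2 - lam) * exp (2 * x / (2 - lam))))\<^sup>2)"
proof -
  define v where "v = lambert_W (lam / (2 - lam) * exp (2 * x / (2 - lam)))"
  define u where "u = (2 / lam - 2) * v + 2 * x / (2 - lam)"
  define w where "w = lambert_W (exp u)"
  define g :: "real \<Rightarrow> real"
    where "g = (\<lambda>u. 1 / 2 * u\<^sup>2 - lambert_W (exp u) - 1 / 2 * (lambert_W (exp u))\<^sup>2)"
  \<comment> \<open>The slope condition, solved for the optimal point of the conjugate of \<open>exp + y\<^sup>2/2\<close>.\<close>
  define a where "a = 2 * x / (2 - lam) - v"
  have pos: "0 < lam / (2 - lam) * exp (2 * x / (2 - lam))"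
    using assms by simp
  have "exp a = exp (2 * x / (2 - lam)) / exp v"
    by (simp add: a_def exp_diff)
  also have "exp (2 * x / (2 - lam)) = (2 - lam) / lam * (v * exp v)"
    using lambert_W_pos(2)[OF pos, folded v_def] assms by simp
  finally have exp_a: "exp a = (2 - lam) / lam * v"
    by simp
  have u: "u = a + exp a"
    using assms unfolding exp_a unfolding u_def a_def by (simp add: field_simps)
  have "(1 - lam) * a + lam * (a + exp a) / 2 = (2 - lam) * a / 2 + lam * exp a / 2"
    by (simp add: field_simps)
  moreover have "(2 - lam) * a = 2 * x - (2 - lam) * v" "lam * exp a = (2 - lam) * v"
    using assms unfolding exp_a unfolding a_def by (auto simp: right_diff_distrib)
  ultimately have slope: "(1 - lam) * a + lam * (a + exp a) / 2 = x"
    by argo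
  have "proximal_average (fenchel_conj ent) lam (fenchel_conj energy) x
      = fenchel_conj (\<lambda>u. ereal ((1 - lam) * g u + lam * (u\<^sup>2 / 4))) x - ereal (1 / 2 * x\<^sup>2)"
    unfolding proximal_average_def fenchel_conj_energy fenchel_conj_ent
      fenchel_conj_exp_plus_square_lambert fenchel_conj_energy_plus_square g_def
    by simp
  also have "\<dots> = ereal (x * u - ((1 - lam) * g u + lam * (u\<^sup>2 / 4)) - 1 / 2 * x\<^sup>2)"
    using fenchel_conj_average[OF _ _ slope] assms unfolding u g_def by simp
  also have "x * u - ((1 - lam) * g u + lam * (u\<^sup>2 / 4)) - 1 / 2 * x\<^sup>2 =
      (1 - lam) * w + 1 / 2 * (1 - lam) * w\<^sup>2 + (x * u - (2 - lam) / 4 * u\<^sup>2 - 1 / 2 * x\<^sup>2)"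
    unfolding g_def w_def[symmetric] by (simp add: field_simps)
  \<comment> \<open>Completing the square: \<open>u - 2 * x / (2 - lam)\<close> is the multiple \<open>2 / lam - 2\<close> of \<open>v\<close>.\<close>
  also have "x * u - (2 - lam) / 4 * u\<^sup>2 - 1 / 2 * x\<^sup>2 =
      lam * x\<^sup>2 / (4 - 2 * lam) - (2 - lam) / 4 * (u - 2 * x / (2 - lam))\<^sup>2"
  proof -
    define b where "b = 2 - lam"
    have "b \<noteq> 0" and lam: "lam = 2 - b"
      using assms by (auto simp: b_def)
    then show ?thesis
      unfolding lam by (simp add: power2_eq_square field_simps)
  qed
  also have "(2 - lam) / 4 * (u - 2 * x / (2 - lam))\<^sup>2 = - ((lam - 1)\<^sup>2 * (lam - 2) / lam\<^sup>2 * v\<^sup>2)"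
  proof -
    have diff: "u - 2 * x / (2 - lam) = 2 * (1 - lam) * v / lam"
      unfolding u_def using assms
      by (simp only: add_diff_cancel_right') (simp add: field_simps)
    show ?thesis
      unfolding diff using assms by (simp add: power2_eq_square field_simps)
  qed
  finally show ?thesis
    unfolding w_def u_def v_def by (simp add: algebra_simps)
qed

end
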